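(* Let $Y$ be a scalar random variable and $X\in\mathbb{R}^p$ a random vector with first component $1$ and support $\mathcal{X}$. For $t\in(0,1)$ let $\beta(t)\in\arg\min_{\beta\in\mathbb{R}^p}\mathrm{E}\,\rho_t(Y-X^\top\beta)$, where $\rho_t(z)=t\max(z,0)+(1-t)\max(-z,0)$ (equivalently $\beta(t)$ minimizes $\mathrm{E}(Y-X^\top\beta)_++(1-t)\mathrm{E}X^\top\beta$), and let $A_t=1(Y>X^\top\beta(t))$. Assume (QR): $\mathrm{E}|Y|<\infty$, $\mathrm{E}\|X\|^2<\infty$, the conditional density $(y,x)\mapsto f_{Y\mid X}(y,x)$ exists and is bounded and uniformly continuous, and $\mathrm{E}(f_{Y\mid X}(X^\top\beta(t),X)XX^\top)$ has full rank for each $t\in(0,1)$. Then: (i) If $t\mapsto x^\top\beta(t)$ is increasing on $(0,1)$ for each $x\in\mathcal{X}$, then $\widetilde U:=\int_0^1A_t\,dt$ satisfies $Y=X^\top\beta(\widetilde U)$ a.s., $\widetilde U\sim U(0,1)$ and $\mathrm{E}(X\mid\widetilde U)=\mathrm{E}(X)$; moreover $\widetilde U$ solves $\max\{\mathrm{E}(VY): V\sim U(0,1),\ \mathrm{E}(X\mid V)=\mathrm{E}(X)\}$. (ii) Under the monotonicity assumption of (i), the representation is unique a.s.: if also $Y=\overline\beta(\overline U)^\top X$ with $\overline U\sim U(0,1)$, $\mathrm{E}(X\mid\overline U)=\mathrm{E}(X)$, and $u\mapsto X^\top\overline\beta(u)$ increasing in $u\in(0,1)$ a.s., then $\widetilde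 U=\overline U$ and $X^\top\beta(\widetilde U)=X^\top\overline\beta(\overline U)$ a.s. (iii) If the conditional quantile function of $Y$ given $X$ is linear, $Q_{Y\mid X}(u)=X^\top\beta_0(u)$, so that $Y=X^\top\beta_0(U)$ with $U\sim U(0,1)$ independent of $X$, then $U=\widetilde U$ and $\beta_0(U)=\beta(U)$ a.s.
   Context: $U(0,1)$ denotes the uniform distribution on $(0,1)$; $z_+=\max(z,0)$. *)

theory Defs
  imports "HOL-Probability.Probability"
begin

definition rho :: "real \<Rightarrow> real \<Rightarrow> real" where
  "rho t z = t * max z 0 + (1 - t) * max (- z) 0"

definition is_qr_coef :: "'a measure \<Rightarrow> ('a \<Rightarrow> real) \<Rightarrow> ('a \<Rightarrow> real^'p) \<Rightarrow> real \<Rightarrow> real^'p \<Rightarrow> bool" where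
  "is_qr_coef M Y X t b \<longleftrightarrow>
     (\<forall>c. (\<integral>\<omega>. rho t (Y \<omega> - X \<omega> \<bullet> b) \<partial>M) \<le> (\<integral>\<omega>. rho t (Y \<omega> - X \<omega> \<bullet> c) \<partial>M))"

definition cond_density :: "'a measure \<Rightarrow> ('a \<Rightarrow> real) \<Rightarrow> ('a \<Rightarrow> real^'p) \<Rightarrow> (real \<Rightarrow> real^'p \<Rightarrow> real) \<Rightarrow> bool" where
  "cond_density M Y X f \<longleftrightarrow>
     (\<forall>y x. 0 \<le> f y x) \<and> case_prod f \<in> borel_measurable borel \<and>
     (\<forall>A\<in>sets borel. \<forall>B\<in>sets borel.
        emeasure M {\<omega>\<in>space M. Y \<omega> \<in> A \<and> X \<omega> \<in> B} =
        (\<integral>\<^sup>+\<omega>. indicator B (X \<omega>) * (\<integral>\<^sup>+y. indicator A y * ennreal (f y (X \<omega>)) \<partial>lborel) \<partial>M))"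

definition supp :: "'a measure \<Rightarrow> ('a \<Rightarrow> real^'p) \<Rightarrow> (real^'p) set" where
  "supp M X = {x. \<forall>e>0. 0 < measure M {\<omega>\<in>space M. X \<omega> \<in> ball x e}}"

definition unif01 :: "'a measure \<Rightarrow> ('a \<Rightarrow> real) \<Rightarrow> bool" where
  "unif01 M V \<longleftrightarrow> V \<in> borel_measurable M \<and> distr M lborel V = uniform_measure lborel {0<..<1}"

definition mean_indep :: "'a measure \<Rightarrow> ('a \<Rightarrow> real^'p) \<Rightarrow> ('a \<Rightarrow> real) \<Rightarrow> bool" where
  "mean_indep M X V \<longleftrightarrow>
     (\<forall>i. AE \<omega> in M. real_cond_exp M (vimage_algebra (space M) V borel) (\<lambda>\<omega>. X \<omega> $ i) \<omega>
                     = (\<integral>\<omega>'. X \<omega>' $ i \<partial>M))"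

definition jac_mat :: "'a measure \<Rightarrow> ('a \<Rightarrow> real^'p) \<Rightarrow> (real \<Rightarrow> real^'p \<Rightarrow> real) \<Rightarrow> real^'p \<Rightarrow> real^'p^'p" where
  "jac_mat M X f b = (\<chi> i j. \<integral>\<omega>. f (X \<omega> \<bullet> b) (X \<omega>) * X \<omega> $ i * X \<omega> $ j \<partial>M)"

definition cond_quantile :: "(real \<Rightarrow> real^'p \<Rightarrow> real) \<Rightarrow> real \<Rightarrow> real^'p \<Rightarrow> real" where
  "cond_quantile f u x = Inf {y. u \<le> (\<integral>s. indicator {..y} s * f s x \<partial>lborel)}"

definition Utilde :: "('a \<Rightarrow> real) \<Rightarrow> ('a \<Rightarrow> real^'p) \<Rightarrow> (real \<Rightarrow> real^'p) \<Rightarrow> 'a \<Rightarrow> real" where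
  "Utilde Y X \<beta> \<omega> = (LBINT t=0..1. (if Y \<omega> > X \<omega> \<bullet> \<beta> t then 1 else 0))"

definition indep_rv :: "'a measure \<Rightarrow> ('a \<Rightarrow> real) \<Rightarrow> ('a \<Rightarrow> real^'p) \<Rightarrow> bool" where
  "indep_rv M U X \<longleftrightarrow> U \<in> borel_measurable M \<and> X \<in> borel_measurable M \<and>
     (\<forall>A\<in>sets borel. \<forall>B\<in>sets borel.
        measure M {\<omega>\<in>space M. U \<omega> \<in> A \<and> X \<omega> \<in> B} =
        measure M {\<omega>\<in>space M. U \<omega> \<in> A} * measure M {\<omega>\<in>space M. X \<omega> \<in> B})"

end

theory Submission
  imports Defs
begin

text \<open>
  Up to a constant the quantile regression loss is the convex function
  \<open>b \<mapsto> E (Y - X \<bullet> b)\<^sub>+ + (1 - t) E X \<bullet> b\<close>, and its Bregman remainder between \<open>b\<close> and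
  \<open>c\<close> is the mean of a nonnegative quantity that is positive exactly when \<open>Y\<close> lies strictly
  between \<open>X \<bullet> b\<close> and \<open>X \<bullet> c\<close>. Hence \<open>b\<close> is a minimizer iff
  \<open>E (1(Y > X \<bullet> b) X) = (1 - t) E X\<close>. If \<open>c\<close> is another minimizer, \<open>Y\<close> almost surely does not
  separate \<open>X \<bullet> b\<close> from \<open>X \<bullet> c\<close>, so by continuity of the conditional density
  \<open>f (X \<bullet> b, X) (X \<bullet> (c - b)) = 0\<close> and the Jacobian kills \<open>c - b\<close>. So minimizers are unique; as
  \<open>t\<close> only tilts a fixed convex function by a linear one, they are continuous in \<open>t\<close>.

  Under monotonicity the events \<open>Utilde > t\<close> and \<open>Y > X \<bullet> \<beta> t\<close> therefore agree, so the first-order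
  conditions say precisely that \<open>Utilde\<close> is uniform and \<open>X\<close> is mean independent of it. Conversely,
  for any monotone representation \<open>Y = X \<bullet> \<gamma> V\<close> the events \<open>V > t\<close> and \<open>Y > X \<bullet> \<gamma> t\<close> agree, so
  \<open>\<gamma> t\<close> satisfies the first-order condition and equals \<open>\<beta> t\<close>; a linear conditional quantile
  function is a special case. Optimality is linear programming duality, level by level: the
  objective at level \<open>t\<close> bounds \<open>E (1(W > t) Y)\<close> for every feasible \<open>W\<close>, with equality at \<open>\<gamma> t\<close>
  for \<open>W = V\<close>, and \<open>E (W Y)\<close> is the integral of \<open>E (1(W > t) Y)\<close> over \<open>t\<close>.
\<close>

subsection \<open>Measure and integration\<close>

lemma integrable_imp_set_integrable:
  fixes f :: "'a \<Rightarrow> 'b::{banach, second_countable_topology}"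
  shows "integrable M f \<Longrightarrow> A \<in> sets M \<Longrightarrow> set_integrable M A f"
  by (simp add: set_integrable_def integrable_mult_indicator)

lemma
  fixes f :: "'a \<Rightarrow> 'b::{banach, second_countable_topology}"
    and T :: "'b \<Rightarrow> 'c::{banach, second_countable_topology}"
  assumes T: "bounded_linear T" and f: "set_integrable M A f"
  shows set_integrable_linear: "set_integrable M A (\<lambda>x. T (f x))"
    and set_integral_linear: "(\<integral>x\<in>A. T (f x) \<partial>M) = T (\<integral>x\<in>A. f x \<partial>M)"
  using integrable_bounded_linear[OF T, of M "\<lambda>x. indicator A x *\<^sub>R f x"]
    integral_bounded_linear[OF T, of M "\<lambda>x. indicator A x *\<^sub>R f x"] f
  by (simp_all add: set_integrable_def set_lebesgue_integral_def
      bounded_linear.linear[OF T] linear_scale)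

lemma set_integral_eq_0_sigma_sets:
  fixes g :: "'a \<Rightarrow> 'b::{banach, second_countable_topology}"
  assumes g: "integrable M g" "(\<integral>x. g x \<partial>M) = 0"
    and G: "Int_stable G" "G \<subseteq> sets M" "\<And>A. A \<in> G \<Longrightarrow> (\<integral>x\<in>A. g x \<partial>M) = 0"
    and "A \<in> sigma_sets (space M) G"
  shows "(\<integral>x\<in>A. g x \<partial>M) = 0"
proof -
  have sets: "A \<in> sets M" if "A \<in> sigma_sets (space M) G" for A
    using sets.sigma_sets_subset[OF G(2)] that by blast
  have set_int: "set_integrable M A g" if "A \<in> sigma_sets (space M) G" for A
    using g(1) sets[OF that] by (rule integrable_imp_set_integrable)
  have "G \<subseteq> Pow (space M)" using G(2) sets.sets_into_space by blast
  with G(1) show ?thesis using \<open>A \<in> sigma_sets (space M) G\<close>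
  proof (induction rule: sigma_sets_induct_disjoint)
    case (compl A)
    have "(\<integral>x\<in>A \<union> (space M - A). g x \<partial>M) = (\<integral>x\<in>A. g x \<partial>M) + (\<integral>x\<in>space M - A. g x \<partial>M)"
      using set_int compl.hyps by (intro set_integral_Un set_int sigma_sets.Compl) auto
    moreover have "A \<union> (space M - A) = space M"
      using sets.sets_into_space[OF sets[OF compl.hyps]] by auto
    ultimately show ?case using g compl.IH by (simp add: set_integral_space)
  next
    case (union A)
    then have "(\<integral>x\<in>(\<Union>i. A i). g x \<partial>M) = (\<Sum>i. (\<integral>x\<in>A i. g x \<partial>M))"
      by (intro lebesgue_integral_countable_add sets set_int sigma_sets.Union)
         (auto simp: disjoint_family_on_def)
    then show ?case using union.IH by simp
  qed (simp_all add: G(3) set_lebesgue_integral_def[of M "{}"])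
qed

lemma set_integral_le_integral_pos_part:
  fixes g :: "'a \<Rightarrow> real"
  assumes "integrable M g" "A \<in> sets M"
  shows "(\<integral>x\<in>A. g x \<partial>M) \<le> (\<integral>x. max (g x) 0 \<partial>M)"
  unfolding set_lebesgue_integral_def
  using assms by (intro integral_mono integrable_mult_indicator) (auto split: split_indicator)

lemma (in sigma_finite_measure) pred_AE:
  assumes P[measurable]: "Measurable.pred (N \<Otimes>\<^sub>M M) (\<lambda>(x, y). P x y)"
  shows "Measurable.pred N (\<lambda>x. AE y in M. P x y)"
proof -
  have "(AE y in M. P x y) \<longleftrightarrow> (\<integral>\<^sup>+y. (if P x y then 0 else 1) \<partial>M) = 0" if "x \<in> space N" for x
  proof -
    have [measurable]: "Measurable.pred M (P x)"
      using measurable_Pair2[OF P that] by simp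
    show ?thesis by (subst nn_integral_0_iff_AE) auto
  qed
  then have "Measurable.pred N (\<lambda>x. AE y in M. P x y) \<longleftrightarrow>
      Measurable.pred N (\<lambda>x. (\<integral>\<^sup>+y. (if P x y then 0 else 1) \<partial>M) = 0)"
    by (rule measurable_cong)
  then show ?thesis by simp
qed

lemma mem_open_segment_real: "y \<in> open_segment p q \<longleftrightarrow> p < y \<and> y < q \<or> q < y \<and> y < p" for y :: real
  by (auto simp: open_segment_eq_real_ivl)

lemma AE_eq_0_open_segment_imp:
  fixes g :: "real \<Rightarrow> real"
  assumes cont: "continuous_on UNIV g" and "a \<noteq> b"
    and ae: "AE y in lborel. y \<in> open_segment a b \<longrightarrow> g y = 0"
  shows "g a = 0"
proof -
  have "closed {y. g y = 0}"
    using cont by (intro closed_Collect_eq continuous_on_const)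
  moreover have "AE y \<in> open_segment a b in lebesgue. y \<in> {y. g y = 0}"
    using ae by (simp add: AE_completion)
  moreover have "open (open_segment a b)"
    by (simp add: open_segment_eq_real_ivl)
  ultimately have zero: "g y = 0" if "y \<in> open_segment a b" for y
    using mem_closed_if_AE_lebesgue_open that by blast
  have "a \<in> closure (open_segment a b)" using \<open>a \<noteq> b\<close> by (simp add: closure_open_segment)
  with continuous_on_subset[OF cont subset_UNIV] zero show ?thesis
    by (rule continuous_constant_on_closure)
qed

subsection \<open>Uniform variables and mean independence\<close>

context prob_space
begin

lemma unif01_measurable: "unif01 M V \<Longrightarrow> V \<in> borel_measurable M"
  by (simp add: unif01_def)

lemma unif01_iff_prob_le:
  "unif01 M V \<longleftrightarrow> V \<in> borel_measurable M \<and> (\<forall>t\<in>{0..1}. prob {\<omega>\<in>space M. V \<omega> \<le> t} = t)"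
proof -
  have "AE x in lborel. indicator {0<..<1::real} x / emeasure lborel {0<..<1::real} =
      ennreal (indicator {0..1::real} x / measure lborel {0..1::real})"
    using AE_lborel_singleton[of "0::real"] AE_lborel_singleton[of "1::real"]
    by eventually_elim (auto split: split_indicator simp: divide_ennreal_def)
  then have "uniform_measure lborel {0<..<1} =
      density lborel (\<lambda>x. ennreal (indicator {0..1::real} x / measure lborel {0..1::real}))"
    unfolding uniform_measure_def by (intro density_cong) auto
  then have "unif01 M V \<longleftrightarrow>
      distributed M lborel V (\<lambda>x. indicator {0..1::real} x / measure lborel {0..1::real})"
    by (auto simp: unif01_def distributed_def)
  then show ?thesis
    using uniform_distributed_iff[of V 0 1] by simp
qed

lemma prob_gt_conv_prob_le:
  fixes V :: "'a \<Rightarrow> real"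
  assumes "V \<in> borel_measurable M"
  shows "prob {\<omega>\<in>space M. t < V \<omega>} = 1 - prob {\<omega>\<in>space M. V \<omega> \<le> t}"
  using assms by (subst prob_compl[symmetric]) (auto intro!: arg_cong[where f=prob])

lemma unif01_iff_prob_gt:
  "unif01 M V \<longleftrightarrow> V \<in> borel_measurable M \<and> (\<forall>t\<in>{0<..<1}. prob {\<omega>\<in>space M. t < V \<omega>} = 1 - t)"
proof (intro iffI conjI ballI)
  assume tails: "V \<in> borel_measurable M \<and> (\<forall>t\<in>{0<..<1}. prob {\<omega>\<in>space M. t < V \<omega>} = 1 - t)"
  then have [measurable]: "V \<in> borel_measurable M" by simp
  let ?F = "\<lambda>t. prob {\<omega>\<in>space M. V \<omega> \<le> t}"
  have cdf_eq: "?F t = t" if "0 < t" "t < 1" for t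
    using tails that prob_gt_conv_prob_le[of V t] by simp
  have mono: "?F s \<le> ?F t" if "s \<le> t" for s t
    using that by (intro finite_measure_mono) auto
  have "?F 0 \<le> w" "w \<le> ?F 1" if "0 < w" "w < 1" for w
    using mono[of 0 w] mono[of w 1] cdf_eq[of w] that by simp_all
  then have "?F 0 \<le> 0" "1 \<le> ?F 1"
    by (auto intro: dense_ge_bounded[OF zero_less_one] dense_le_bounded[OF zero_less_one])
  then have "?F t = t" if "t \<in> {0..1}" for t
    using that cdf_eq[of t] prob_le_1[of "{\<omega>\<in>space M. V \<omega> \<le> 1}"]
      measure_nonneg[of M "{\<omega>\<in>space M. V \<omega> \<le> 0}"]
    by (cases "t = 0"; cases "t = 1") auto
  then show "unif01 M V"
    by (simp add: unif01_iff_prob_le)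
qed (auto simp: unif01_iff_prob_le prob_gt_conv_prob_le)

lemma unif01_prob_gt: "unif01 M V \<Longrightarrow> t \<in> {0<..<1} \<Longrightarrow> prob {\<omega>\<in>space M. t < V \<omega>} = 1 - t"
  by (simp add: unif01_iff_prob_gt)

lemma AE_unif01:
  assumes "unif01 M V"
  shows "AE \<omega> in M. V \<omega> \<in> {0<..<1}"
proof -
  have "AE x in distr M lborel V. x \<in> {0<..<1}"
    unfolding assms[unfolded unif01_def, THEN conjunct2] by (rule AE_uniform_measureI) auto
  then show ?thesis
    using unif01_measurable[OF assms] by (subst (asm) AE_distr_iff) auto
qed

end

lemma (in prob_space) finite_measure_subalgebra_vimage:
  assumes "V \<in> borel_measurable M"
  shows "finite_measure_subalgebra M (vimage_algebra (space M) V borel)"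
proof unfold_locales
  have "sets (vimage_algebra (space M) V borel) \<subseteq> sets M"
    using measurable_sets[OF assms] by (auto simp: sets_vimage_algebra2)
  then show "subalgebra M (vimage_algebra (space M) V borel)"
    by (simp add: subalgebra_def)
qed

lemma (in finite_measure_subalgebra) real_cond_exp_eq_const_iff:
  assumes f: "integrable M f"
  shows "(AE x in M. real_cond_exp M F f x = c) \<longleftrightarrow>
    (\<forall>A\<in>sets F. (\<integral>x\<in>A. f x \<partial>M) = measure M A * c)"
proof (intro iffI ballI)
  fix A assume ae: "AE x in M. real_cond_exp M F f x = c" and A: "A \<in> sets F"
  then have [measurable]: "A \<in> sets M" using subalg by (auto simp: subalgebra_def)
  have "(\<integral>x\<in>A. f x \<partial>M) = (\<integral>x\<in>A. real_cond_exp M F f x \<partial>M)"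
    by (rule real_cond_exp_intA[OF f A])
  also have "\<dots> = (\<integral>x\<in>A. c \<partial>M)"
    using ae by (intro set_lebesgue_integral_cong_AE) auto
  finally show "(\<integral>x\<in>A. f x \<partial>M) = measure M A * c"
    by (simp add: set_lebesgue_integral_def)
next
  assume "\<forall>A\<in>sets F. (\<integral>x\<in>A. f x \<partial>M) = measure M A * c"
  moreover have "(\<integral>x\<in>A. c \<partial>M) = measure M A * c" if "A \<in> sets F" for A
    using that subalg by (auto simp: subalgebra_def set_lebesgue_integral_def)
  ultimately show "AE x in M. real_cond_exp M F f x = c"
    using f by (intro real_cond_exp_charact) auto
qed

definition tail_mean ::
  "'a measure \<Rightarrow> ('a \<Rightarrow> real) \<Rightarrow> ('a \<Rightarrow> 'b::{banach, second_countable_topology}) \<Rightarrow> real \<Rightarrow> 'b" where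
  "tail_mean M V Z t = (\<integral>\<omega>\<in>{\<omega>\<in>space M. t < V \<omega>}. Z \<omega> \<partial>M)"

lemma tail_mean_cong_AE:
  assumes [measurable]: "V \<in> borel_measurable M" "W \<in> borel_measurable M" "Z \<in> borel_measurable M"
    and "AE \<omega> in M. s < V \<omega> \<longleftrightarrow> t < W \<omega>"
  shows "tail_mean M V Z s = tail_mean M W Z t"
  unfolding tail_mean_def
  using assms(4) by (intro set_integral_cong_set) (auto simp: set_borel_measurable_def)

context prob_space
begin

lemma mean_indep_iff_set_integral_nth:
  fixes X :: "'a \<Rightarrow> real^'p"
  assumes X: "integrable M X" and V: "V \<in> borel_measurable M"
  shows "mean_indep M X V \<longleftrightarrow> (\<forall>i. \<forall>B\<in>sets borel.
    (\<integral>\<omega>\<in>V -` B \<inter> space M. X \<omega> $ i \<partial>M) = prob (V -` B \<inter> space M) * (\<integral>\<omega>. X \<omega> $ i \<partial>M))"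
proof -
  interpret F: finite_measure_subalgebra M "vimage_algebra (space M) V borel"
    by (rule finite_measure_subalgebra_vimage[OF V])
  show ?thesis
    unfolding mean_indep_def
      F.real_cond_exp_eq_const_iff[OF integrable_bounded_linear[OF bounded_linear_vec_nth X]]
    by (auto simp: sets_vimage_algebra2)
qed

lemma mean_indep_iff_set_integral:
  fixes X :: "'a \<Rightarrow> real^'p"
  assumes X: "integrable M X" and V: "V \<in> borel_measurable M"
  shows "mean_indep M X V \<longleftrightarrow>
    (\<forall>B\<in>sets borel. (\<integral>\<omega>\<in>V -` B \<inter> space M. X \<omega> \<partial>M) = prob (V -` B \<inter> space M) *\<^sub>R expectation X)"
  by (auto simp: mean_indep_iff_set_integral_nth[OF X V] vec_eq_iff X
      integrable_imp_set_integrable measurable_sets[OF V]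
      integral_bounded_linear[OF bounded_linear_vec_nth, symmetric]
      set_integral_linear[OF bounded_linear_vec_nth, symmetric])

lemma tail_mean_eq_0_imp_set_integral_vimage_eq_0:
  fixes g :: "'a \<Rightarrow> 'b::{banach, second_countable_topology}"
  assumes g: "integrable M g" "(\<integral>\<omega>. g \<omega> \<partial>M) = 0" and [measurable]: "V \<in> borel_measurable M"
    and tail: "\<And>t. tail_mean M V g t = 0" and B: "B \<in> sets borel"
  shows "(\<integral>\<omega>\<in>V -` B \<inter> space M. g \<omega> \<partial>M) = 0"
proof (rule set_integral_eq_0_sigma_sets[OF g])
  let ?G = "{V -` {t<..} \<inter> space M |t. True}"
  show "Int_stable ?G"
  proof (rule Int_stableI)
    fix a b assume "a \<in> ?G" "b \<in> ?G"
    then obtain s t where "a = V -` {s<..} \<inter> space M" "b = V -` {t<..} \<inter> space M" by auto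
    then have "a \<inter> b = V -` {max s t<..} \<inter> space M" by auto
    then show "a \<inter> b \<in> ?G" by blast
  qed
  show "?G \<subseteq> sets M" by auto
  have "V -` {t<..} \<inter> space M = {\<omega>\<in>space M. t < V \<omega>}" for t by auto
  then show "(\<integral>\<omega>\<in>A. g \<omega> \<partial>M) = 0" if "A \<in> ?G" for A
    using that tail by (auto simp: tail_mean_def)
  have "sets (vimage_algebra (space M) V (sigma UNIV (range greaterThan))) =
      sigma_sets (space M) ?G"
    by (subst vimage_algebra_sigma)
       (auto simp: image_def
          intro!: sets_measure_of[THEN trans] arg_cong[where f="sigma_sets (space M)"])
  then show "V -` B \<inter> space M \<in> sigma_sets (space M) ?G"
    using in_vimage_algebra[OF B, of V "space M"] by (simp add: borel_Ioi)
qed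

lemma mean_indep_iff_tail_mean:
  fixes X :: "'a \<Rightarrow> real^'p"
  assumes X: "integrable M X" and V[measurable]: "V \<in> borel_measurable M"
  shows "mean_indep M X V \<longleftrightarrow>
    (\<forall>t. tail_mean M V X t = prob {\<omega>\<in>space M. t < V \<omega>} *\<^sub>R expectation X)"
proof
  assume mi: "mean_indep M X V"
  have Ioi: "{\<omega>\<in>space M. t < V \<omega>} = V -` {t<..} \<inter> space M" for t by auto
  show "\<forall>t. tail_mean M V X t = prob {\<omega>\<in>space M. t < V \<omega>} *\<^sub>R expectation X"
    using mi unfolding mean_indep_iff_set_integral[OF X V] tail_mean_def Ioi by simp
next
  assume tail: "\<forall>t. tail_mean M V X t = prob {\<omega>\<in>space M. t < V \<omega>} *\<^sub>R expectation X"
  let ?g = "\<lambda>\<omega>. X \<omega> - expectation X"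
  have set_g: "(\<integral>\<omega>\<in>A. ?g \<omega> \<partial>M) = (\<integral>\<omega>\<in>A. X \<omega> \<partial>M) - prob A *\<^sub>R expectation X" if "A \<in> sets M" for A
    using X that
    by (subst set_integral_diff)
       (auto intro!: integrable_imp_set_integrable simp: set_integral_const emeasure_eq_measure)
  have "(\<integral>\<omega>\<in>V -` B \<inter> space M. ?g \<omega> \<partial>M) = 0" if "B \<in> sets borel" for B
  proof (rule tail_mean_eq_0_imp_set_integral_vimage_eq_0[OF _ _ V _ that])
    show "integrable M ?g" "(\<integral>\<omega>. ?g \<omega> \<partial>M) = 0"
      using X by (auto simp: prob_space)
    show "tail_mean M V ?g t = 0" for t
      using tail by (simp add: tail_mean_def set_g)
  qed
  then show "mean_indep M X V"
    unfolding mean_indep_iff_set_integral[OF X V] by (simp add: set_g)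
qed

lemma mean_indep_iff_tail_mean_unif01:
  fixes X :: "'a \<Rightarrow> real^'p"
  assumes X: "integrable M X" and V: "unif01 M V"
  shows "mean_indep M X V \<longleftrightarrow> (\<forall>t\<in>{0<..<1}. tail_mean M V X t = (1 - t) *\<^sub>R expectation X)"
proof -
  note [measurable] = unif01_measurable[OF V]
  have "tail_mean M V X t = prob {\<omega>\<in>space M. t < V \<omega>} *\<^sub>R expectation X" if "t \<notin> {0<..<1}" for t
  proof (cases "t \<le> 0")
    case True
    then have "AE \<omega> in M. t < V \<omega>" using AE_unif01[OF V] by (auto elim: eventually_mono)
    then have "tail_mean M V X t = tail_mean M (\<lambda>_. 1) X 0" "prob {\<omega>\<in>space M. t < V \<omega>} = 1"
      using X by (auto intro!: tail_mean_cong_AE simp: prob_Collect_eq_1)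
    then show ?thesis using X by (simp add: tail_mean_def set_integral_space)
  next
    case False
    with that have "AE \<omega> in M. \<not> t < V \<omega>" using AE_unif01[OF V] by (auto elim: eventually_mono)
    then have "tail_mean M V X t = tail_mean M (\<lambda>_. 0) X 0" "prob {\<omega>\<in>space M. t < V \<omega>} = 0"
      using X by (auto intro!: tail_mean_cong_AE simp: prob_Collect_eq_0)
    then show ?thesis by (simp add: tail_mean_def set_lebesgue_integral_def)
  qed
  then show ?thesis
    using unif01_prob_gt[OF V] by (metis mean_indep_iff_tail_mean[OF X unif01_measurable[OF V]])
qed

lemma indep_rv_compose:
  fixes X :: "'a \<Rightarrow> real^'p" and g :: "real^'p \<Rightarrow> real"
  assumes ind: "indep_rv M U X" and g[measurable]: "g \<in> borel_measurable borel"
  shows "indep_var borel U borel (\<lambda>\<omega>. g (X \<omega>))"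
  unfolding indep_var_distribution_eq
proof (intro conjI pair_measure_eqI)
  show [measurable]: "U \<in> borel_measurable M" "(\<lambda>\<omega>. g (X \<omega>)) \<in> borel_measurable M"
    using ind by (auto simp: indep_rv_def)
  show "sigma_finite_measure (distr M borel U)" "sigma_finite_measure (distr M borel (\<lambda>\<omega>. g (X \<omega>)))"
    by (auto intro!: prob_space_imp_sigma_finite prob_space_distr)
  fix A B assume "A \<in> sets (distr M borel U)" "B \<in> sets (distr M borel (\<lambda>\<omega>. g (X \<omega>)))"
  then have A[measurable]: "A \<in> sets borel" and B[measurable]: "B \<in> sets borel" by auto
  have "g -` B \<in> sets borel" by (rule measurable_sets_borel[OF g B])
  with A have "prob {\<omega>\<in>space M. U \<omega> \<in> A \<and> X \<omega> \<in> g -` B} =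
      prob {\<omega>\<in>space M. U \<omega> \<in> A} * prob {\<omega>\<in>space M. X \<omega> \<in> g -` B}"
    using ind unfolding indep_rv_def by blast
  then show "emeasure (distr M borel U) A * emeasure (distr M borel (\<lambda>\<omega>. g (X \<omega>))) B =
      emeasure (distr M (borel \<Otimes>\<^sub>M borel) (\<lambda>\<omega>. (U \<omega>, g (X \<omega>)))) (A \<times> B)"
    by (simp add: emeasure_distr emeasure_eq_measure vimage_def Int_def conj_commute ennreal_mult)
qed simp

lemma indep_rv_imp_mean_indep:
  fixes X :: "'a \<Rightarrow> real^'p"
  assumes X: "integrable M X" and ind: "indep_rv M U X"
  shows "mean_indep M X U"
proof -
  have U[measurable]: "U \<in> borel_measurable M"
    using ind by (simp add: indep_rv_def)
  have set_integral_eq: "(\<integral>\<omega>\<in>U -` B \<inter> space M. h \<omega> \<partial>M) = (\<integral>\<omega>. indicator B (U \<omega>) * h \<omega> \<partial>M)"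
    for B and h :: "'a \<Rightarrow> real"
    unfolding set_lebesgue_integral_def
    by (intro Bochner_Integration.integral_cong) (auto split: split_indicator)
  have "(\<integral>\<omega>\<in>U -` B \<inter> space M. X \<omega> $ i \<partial>M) = prob (U -` B \<inter> space M) * (\<integral>\<omega>. X \<omega> $ i \<partial>M)"
    if [measurable]: "B \<in> sets borel" for B i
  proof -
    have "indep_var borel (indicat_real B \<circ> U) borel (id \<circ> (\<lambda>\<omega>. X \<omega> $ i))"
      using ind by (intro indep_var_compose[OF indep_rv_compose]) auto
    then have "(\<integral>\<omega>. indicat_real B (U \<omega>) * X \<omega> $ i \<partial>M) =
        (\<integral>\<omega>. indicat_real B (U \<omega>) \<partial>M) * (\<integral>\<omega>. X \<omega> $ i \<partial>M)"
      by (intro indep_var_lebesgue_integral integrable_const_bound[of _ 1]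
          integrable_bounded_linear[OF bounded_linear_vec_nth X]) (auto simp: comp_def)
    moreover have "(\<integral>\<omega>. indicat_real B (U \<omega>) \<partial>M) = prob (U -` B \<inter> space M)"
      using set_integral_eq[of B "\<lambda>_. 1"] by (simp add: set_lebesgue_integral_def)
    ultimately show ?thesis by (simp add: set_integral_eq)
  qed
  then show ?thesis by (simp add: mean_indep_iff_set_integral_nth[OF X U])
qed

lemma integrable_pair_indicator_Ioo:
  fixes g :: "'a \<Rightarrow> 'b::{banach, second_countable_topology}"
  assumes [measurable]: "V \<in> borel_measurable M" "g \<in> borel_measurable M"
    and bound: "integrable M (\<lambda>\<omega>. max 0 (V \<omega>) * norm (g \<omega>))"
  shows "integrable (M \<Otimes>\<^sub>M lborel) (\<lambda>(\<omega>, t). indicat_real {0<..<V \<omega>} t *\<^sub>R g \<omega>)"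
proof -
  interpret P: pair_sigma_finite M "lborel :: real measure" ..
  have length: "measure lborel {0<..<v} = max 0 v" for v :: real
    by (cases "0 \<le> v") auto
  show ?thesis
  proof (rule P.Fubini_integrable)
    show "(\<lambda>(\<omega>, t). indicat_real {0<..<V \<omega>} t *\<^sub>R g \<omega>) \<in> borel_measurable (M \<Otimes>\<^sub>M lborel)"
      by (simp add: indicator_def)
  qed (auto simp: bound length
      intro!: integrable_scaleR_left integrable_real_indicator emeasure_bounded_finite)
qed

lemma
  fixes g :: "'a \<Rightarrow> 'b::{banach, second_countable_topology}"
  assumes [measurable]: "V \<in> borel_measurable M"
    and unit: "AE \<omega> in M. V \<omega> \<in> {0..1}" and g: "integrable M g"
  shows set_integrable_tail_mean: "set_integrable lborel {0<..<1} (tail_mean M V g)"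
    and integral_scaleR_eq_tail_mean:
      "(\<integral>\<omega>. V \<omega> *\<^sub>R g \<omega> \<partial>M) = (\<integral>t\<in>{0<..<1}. tail_mean M V g t \<partial>lborel)"
proof -
  interpret P: pair_sigma_finite M "lborel :: real measure" ..
  have [measurable]: "g \<in> borel_measurable M" using g by simp
  define h where "h \<omega> t = indicat_real {0<..<V \<omega>} t *\<^sub>R g \<omega>" for \<omega> t
  have "AE \<omega> in M. norm (max 0 (V \<omega>) * norm (g \<omega>)) \<le> norm (g \<omega>)"
    using unit by eventually_elim (simp add: mult_left_le_one_le)
  then have "integrable M (\<lambda>\<omega>. max 0 (V \<omega>) * norm (g \<omega>))"
    by (intro Bochner_Integration.integrable_bound[OF g]) auto
  then have integrable_h: "integrable (M \<Otimes>\<^sub>M lborel) (case_prod h)"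
    unfolding h_def[abs_def] by (intro integrable_pair_indicator_Ioo) auto
  note [measurable] = borel_measurable_integrable[OF this]
  have tail: "(\<integral>\<omega>. h \<omega> t \<partial>M) = indicator {0<..<1} t *\<^sub>R tail_mean M V g t" for t
  proof -
    have "(\<integral>\<omega>. h \<omega> t \<partial>M) =
        (\<integral>\<omega>. indicator {0<..<1} t *\<^sub>R indicator {\<omega>\<in>space M. t < V \<omega>} \<omega> *\<^sub>R g \<omega> \<partial>M)"
    proof (rule integral_cong_AE)
      show "AE \<omega> in M. h \<omega> t = indicator {0<..<1} t *\<^sub>R indicator {\<omega>\<in>space M. t < V \<omega>} \<omega> *\<^sub>R g \<omega>"
        using unit AE_space unfolding h_def by eventually_elim (auto split: split_indicator)
    qed measurable
    then show ?thesis by (simp add: tail_mean_def set_lebesgue_integral_def del: scaleR_scaleR)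
  qed
  show "set_integrable lborel {0<..<1} (tail_mean M V g)"
    using P.integrable_snd[OF integrable_h] by (simp add: set_integrable_def tail)
  have "(\<integral>t\<in>{0<..<1}. tail_mean M V g t \<partial>lborel) = (\<integral>\<omega>. (\<integral>t. h \<omega> t \<partial>lborel) \<partial>M)"
    using P.Fubini_integral[OF integrable_h] by (simp add: set_lebesgue_integral_def tail)
  also have "\<dots> = (\<integral>\<omega>. V \<omega> *\<^sub>R g \<omega> \<partial>M)"
  proof (rule integral_cong_AE)
    show "AE \<omega> in M. (\<integral>t. h \<omega> t \<partial>lborel) = V \<omega> *\<^sub>R g \<omega>"
      using unit by eventually_elim (simp add: h_def)
  qed measurable
  finally show "(\<integral>\<omega>. V \<omega> *\<^sub>R g \<omega> \<partial>M) = (\<integral>t\<in>{0<..<1}. tail_mean M V g t \<partial>lborel)" ..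
qed

end

subsection \<open>Supports and conditional quantiles\<close>

lemma (in prob_space) AE_in_supp:
  fixes X :: "'a \<Rightarrow> real^'p"
  assumes [measurable]: "X \<in> borel_measurable M"
  shows "AE \<omega> in M. X \<omega> \<in> supp M X"
proof -
  let ?null = "{ball x e |x e. 0 < e \<and> prob {\<omega>\<in>space M. X \<omega> \<in> ball x e} = 0}"
  have supp: "- supp M X \<subseteq> \<Union>?null"
  proof
    fix x assume "x \<in> - supp M X"
    then obtain e where "0 < e" "prob {\<omega>\<in>space M. X \<omega> \<in> ball x e} = 0"
      by (auto simp: supp_def zero_less_measure_iff)
    then show "x \<in> \<Union>?null" using centre_in_ball[of x e] by blast
  qed
  obtain F where cover: "F \<subseteq> ?null" "countable F" "\<Union>F = \<Union>?null"
    by (rule Lindelof[of ?null]) auto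
  have "AE \<omega> in M. X \<omega> \<notin> B" if "B \<in> F" for B
    using that cover(1) by (auto simp: prob_Collect_eq_0[symmetric])
  then have "AE \<omega> in M. \<forall>B\<in>F. X \<omega> \<notin> B"
    by (rule AE_ball_countable'[OF _ cover(2)])
  then show ?thesis
    by eventually_elim (use supp cover(3) in blast)
qed

context cdf_distribution
begin

lemma cdf_I_eq:
  assumes u: "u \<in> {0<..<1}" and cont: "isCont C (I u)"
  shows "C (I u) = u"
proof (rule antisym)
  show "u \<le> C (I u)" using u pseudoinverse[of u "I u"] by simp
  have "(C \<longlongrightarrow> C (I u)) (at_left (I u))"
    using cont by (simp add: isCont_def filterlim_at_split)
  moreover have "C y \<le> u" if "y < I u" for y
    using pseudoinverse[of u y] u that by simp
  then have "\<forall>\<^sub>F y in at_left (I u). C y \<le> u"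
    unfolding eventually_at_left_field by (intro exI[of _ "I u - 1"]) simp
  ultimately show "C (I u) \<le> u"
    by (rule tendsto_upperbound) simp
qed

lemma I_strict_mono:
  assumes "\<And>x. measure M {x} = 0"
  shows "strict_mono_on {0<..<1} I"
proof (rule strict_mono_onI)
  fix u v :: real assume uv: "u \<in> {0<..<1}" "v \<in> {0<..<1}" "u < v"
  then have "I u \<le> I v" by (intro mono_onD[OF mono_I]) auto
  moreover have "I u \<noteq> I v" using uv cdf_I_eq[of u] cdf_I_eq[of v] by (auto simp: isCont_cdf assms)
  ultimately show "I u < I v" by simp
qed

end

lemma cond_quantile_strict_mono:
  assumes [measurable]: "(\<lambda>y. f y x) \<in> borel_measurable borel" and nonneg: "\<And>y. 0 \<le> f y x"
    and int1: "(\<integral>\<^sup>+y. ennreal (f y x) \<partial>lborel) = 1"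
  shows "strict_mono_on {0<..<1} (\<lambda>u. cond_quantile f u x)"
proof -
  define N where "N = density lborel (\<lambda>y. ennreal (f y x))"
  have "prob_space N" by (rule prob_spaceI) (simp add: N_def emeasure_density int1)
  then interpret N: cdf_distribution N
    by (simp add: cdf_distribution_def real_distribution_def real_distribution_axioms_def N_def)
  have "(\<integral>s. indicator {..y} s * f s x \<partial>lborel) = cdf N y" for y
  proof -
    have "cdf N y = (\<integral>s. indicator {..y} s \<partial>N)" by (simp add: cdf_def)
    also have "\<dots> = (\<integral>s. f s x *\<^sub>R indicator {..y} s \<partial>lborel)"
      unfolding N_def by (rule integral_density) (auto simp: nonneg)
    finally show ?thesis by (simp add: mult.commute)
  qed
  moreover have "emeasure N {y} = 0" for y
    using AE_lborel_singleton[of y] unfolding N_def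
    by (subst emeasure_density) (auto simp: nn_integral_0_iff_AE elim: eventually_mono)
  then have "strict_mono_on {0<..<1} N.I"
    by (intro N.I_strict_mono) (simp add: measure_def)
  ultimately show ?thesis by (simp add: cond_quantile_def)
qed

subsection \<open>Minimizers of tilted convex functions\<close>

lemma convex_minimizer_in_ball:
  fixes g :: "'b::real_normed_vector \<Rightarrow> real"
  assumes g: "convex_on UNIV g" and min: "\<And>y. g x \<le> g y"
    and e_pos: "0 < e" and sphere: "\<And>c. c \<in> sphere b e \<Longrightarrow> g b < g c"
  shows "dist x b < e"
proof (rule ccontr)
  assume "\<not> dist x b < e"
  then have far: "e \<le> norm (x - b)" by (simp add: dist_norm)
  define u where "u = e / norm (x - b)"
  have u_bounds: "0 < u" "u \<le> 1"
    using e_pos far by (auto simp: u_def divide_le_eq_1 intro!: divide_pos_pos)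
  define c where "c = (1 - u) *\<^sub>R b + u *\<^sub>R x"
  have "c - b = u *\<^sub>R (x - b)" by (simp add: c_def algebra_simps)
  then have "norm (c - b) = e" using e_pos far by (auto simp: u_def)
  then have "c \<in> sphere b e" by (simp add: dist_norm norm_minus_commute)
  then have "g b < g c" by (rule sphere)
  also have "g c \<le> (1 - u) * g b + u * g x"
    unfolding c_def using convex_onD[OF g, of u b x] u_bounds by simp
  also have "\<dots> \<le> (1 - u) * g b + u * g b"
    using min u_bounds by (intro add_left_mono mult_left_mono) auto
  finally show False by (simp add: algebra_simps)
qed

lemma convex_on_inner: "convex_on UNIV (\<lambda>b. v \<bullet> b)"
  by (rule convex_onI) (auto simp: inner_add_right)

lemma continuous_on_tilted_minimizer:
  fixes g :: "'b::euclidean_space \<Rightarrow> real" and v \<beta> :: "'t::metric_space \<Rightarrow> 'b"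
  assumes g: "convex_on UNIV g" and v: "continuous_on T v"
    and min: "\<And>t c. t \<in> T \<Longrightarrow> g (\<beta> t) + v t \<bullet> \<beta> t \<le> g c + v t \<bullet> c"
    and unique: "\<And>t b. t \<in> T \<Longrightarrow> (\<And>c. g b + v t \<bullet> b \<le> g c + v t \<bullet> c) \<Longrightarrow> b = \<beta> t"
  shows "continuous_on T \<beta>"
  unfolding continuous_on_iff
proof (intro ballI allI impI)
  fix s e assume s: "s \<in> T" and e_pos: "0 < (e::real)"
  define h where "h t c = g c + v t \<bullet> c" for t c
  have convex: "convex_on UNIV (h t)" for t
    unfolding h_def[abs_def] using g by (intro convex_on_add convex_on_inner)
  let ?S = "sphere (\<beta> s) e"
  have cont: "continuous_on ?S (h s)"
    using convex_on_continuous[OF open_UNIV convex] by (rule continuous_on_subset) simp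
  have "compact ?S" "?S \<noteq> {}" using e_pos by auto
  from continuous_attains_inf[OF this cont] obtain m
    where m_min: "m \<in> ?S" "\<And>c. c \<in> ?S \<Longrightarrow> h s m \<le> h s c"
    by blast
  define \<delta> where "\<delta> = h s m - h s (\<beta> s)"
  have "m \<noteq> \<beta> s" using m_min e_pos by auto
  then have "\<delta> > 0"
    using unique[OF s, of m] min[OF s] unfolding \<delta>_def h_def
    by (metis diff_gt_0_iff_gt not_le order_trans)
  then have "0 < \<delta> / e" using e_pos by simp
  with v s obtain d
    where d_bound: "0 < d" "\<And>t. t \<in> T \<Longrightarrow> dist t s < d \<Longrightarrow> dist (v t) (v s) < \<delta> / e"
    unfolding continuous_on_iff by blast
  have "dist (\<beta> t) (\<beta> s) < e" if t: "t \<in> T" "dist t s < d" for t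
  proof (rule convex_minimizer_in_ball[OF convex[of t] _ e_pos])
    show "h t (\<beta> t) \<le> h t c" for c using min[OF t(1)] by (simp add: h_def)
    fix c assume c: "c \<in> ?S"
    have "\<bar>(v t - v s) \<bullet> (\<beta> s - c)\<bar> \<le> norm (v t - v s) * e"
      using Cauchy_Schwarz_ineq2[of "v t - v s" "\<beta> s - c"] c by (simp add: dist_norm)
    also have "\<dots> < \<delta>" using d_bound(2)[OF t] e_pos by (simp add: dist_norm field_simps)
    also have "\<delta> \<le> h s c - h s (\<beta> s)" using m_min(2)[OF c] by (simp add: \<delta>_def)
    finally show "h t (\<beta> s) < h t c" by (auto simp: h_def algebra_simps abs_less_iff)
  qed
  then show "\<exists>d>0. \<forall>t\<in>T. dist t s < d \<longrightarrow> dist (\<beta> t) (\<beta> s) < e" using d_bound(1) by blast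
qed

subsection \<open>Sublevel sets of monotone functions on the unit interval\<close>

definition sublevel_length :: "(real \<Rightarrow> real) \<Rightarrow> real \<Rightarrow> real" where
  "sublevel_length g y = measure lborel {t\<in>{0<..<1}. g t < y}"

lemma sublevel_length_self:
  assumes "strict_mono_on {0<..<1} g" "t \<in> {0<..<1}"
  shows "sublevel_length g (g t) = t"
proof -
  have "{s\<in>{0<..<1}. g s < g t} = {0<..<t}"
    using assms strict_mono_on_less[OF assms(1) _ assms(2)] by auto
  then show ?thesis using assms(2) by (simp add: sublevel_length_def)
qed

lemma less_sublevel_length_iff:
  assumes mono: "strict_mono_on {0<..<1} g" and cont: "continuous_on {0<..<1} g"
    and t: "t \<in> {0<..<1}"
  shows "t < sublevel_length g y \<longleftrightarrow> g t < y"
proof -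
  let ?S = "{t\<in>{0<..<1}. g t < y}"
  have open_S: "open ?S"
    using continuous_open_preimage[OF cont _ open_lessThan[of y]] by (simp add: vimage_def Int_def)
  have Ioo: "{0<..<s} \<in> fmeasurable lborel" for s :: real
    using fmeasurable_box[of 0 s] by simp
  have S_fmeasurable: "?S \<in> fmeasurable lborel"
    using open_S by (intro fmeasurableI2[OF Ioo[of 1]] subsetI) simp_all
  show ?thesis
  proof
    assume "g t < y"
    then obtain e where "0 < e" "ball t e \<subseteq> ?S"
      using open_S t by (metis (mono_tags, lifting) mem_Collect_eq openE)
    moreover have "t + e / 2 \<in> ball t e" using \<open>0 < e\<close> by (simp add: dist_real_def)
    ultimately have "t + e / 2 \<in> ?S" by blast
    then have "{0<..<t + e / 2} \<subseteq> ?S"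
      using strict_mono_onD[OF mono, of _ "t + e / 2"] by fastforce
    then have "measure lborel {0<..<t + e / 2} \<le> measure lborel ?S"
      using S_fmeasurable Ioo by (intro measure_mono_fmeasurable fmeasurableD)
    with \<open>0 < e\<close> t show "t < sublevel_length g y" by (simp add: sublevel_length_def)
  next
    assume less: "t < sublevel_length g y"
    show "g t < y"
    proof (rule ccontr)
      assume "\<not> g t < y"
      then have "?S \<subseteq> {0<..<t}"
        using strict_mono_on_leD[OF mono t] by (force simp: not_less)
      then have "measure lborel ?S \<le> measure lborel {0<..<t}"
        using S_fmeasurable Ioo by (intro measure_mono_fmeasurable fmeasurableD)
      with less t show False by (simp add: sublevel_length_def)
    qed
  qed
qed

lemma sublevel_length_inverse:
  assumes mono: "strict_mono_on {0<..<1} g" and cont: "continuous_on {0<..<1} g"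
    and u: "sublevel_length g y \<in> {0<..<1}"
  shows "g (sublevel_length g y) = y"
proof (rule antisym)
  let ?u = "sublevel_length g y"
  show "y \<le> g ?u" using less_sublevel_length_iff[OF mono cont u, of y] by simp
  have "isCont g ?u" using cont u by (simp add: continuous_on_eq_continuous_at)
  then have "(g \<longlongrightarrow> g ?u) (at_left ?u)" by (simp add: isCont_def filterlim_at_split)
  moreover have "g t \<le> y" if "0 < t" "t < ?u" for t
    using less_sublevel_length_iff[OF mono cont, of t y] that u by (simp add: less_imp_le)
  then have "\<forall>\<^sub>F t in at_left ?u. g t \<le> y"
    unfolding eventually_at_left_field using u by (intro exI[of _ 0]) simp
  ultimately show "g ?u \<le> y" by (rule tendsto_upperbound) simp
qed

subsection \<open>The quantile regression objective\<close>

lemma rho_eq: "rho t z = max z 0 - (1 - t) * z"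
  by (auto simp: rho_def max_def algebra_simps)

text \<open>Bregman remainder at \<open>p\<close>, evaluated at \<open>q\<close>, of the convex function \<open>p \<mapsto> (y - p)\<^sub>+\<close>.\<close>
definition hinge_gap :: "real \<Rightarrow> real \<Rightarrow> real \<Rightarrow> real" where
  "hinge_gap y p q = max (y - q) 0 - max (y - p) 0 + (if p < y then q - p else 0)"

lemma hinge_gap_nonneg: "0 \<le> hinge_gap y p q"
  and hinge_gap_le: "hinge_gap y p q \<le> \<bar>q - p\<bar>"
  by (auto simp: hinge_gap_def max_def)

lemma hinge_gap_eq_0: "\<bar>q - p\<bar> < \<bar>y - p\<bar> \<Longrightarrow> hinge_gap y p q = 0"
  by (auto simp: hinge_gap_def max_def)

lemma hinge_gap_eq_0_imp: "hinge_gap y p q = 0 \<Longrightarrow> y \<notin> open_segment p q"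
  by (auto simp: hinge_gap_def mem_open_segment_real max_def split: if_splits)

lemma borel_measurable_hinge_gap[measurable (raw)]:
  assumes [measurable]: "u \<in> borel_measurable M" "v \<in> borel_measurable M" "w \<in> borel_measurable M"
  shows "(\<lambda>x. hinge_gap (u x) (v x) (w x)) \<in> borel_measurable M"
  unfolding hinge_gap_def by measurable

locale linear_regression = prob_space M for M :: "'a measure" +
  fixes Y :: "'a \<Rightarrow> real" and X :: "'a \<Rightarrow> real^'p"
  assumes integrable_Y: "integrable M Y" and integrable_X: "integrable M X"
begin

lemma borel_measurable_Y[measurable]: "Y \<in> borel_measurable M"
  and borel_measurable_X[measurable]: "X \<in> borel_measurable M"
  using integrable_Y integrable_X by auto

lemma integrable_residual: "integrable M (\<lambda>\<omega>. Y \<omega> - X \<omega> \<bullet> b)"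
  using integrable_Y integrable_X by simp

lemma integrable_excess: "integrable M (\<lambda>\<omega>. max (Y \<omega> - X \<omega> \<bullet> b) 0)"
  using integrable_residual by simp

definition mean_excess :: "real^'p \<Rightarrow> real" where
  "mean_excess b = (\<integral>\<omega>. max (Y \<omega> - X \<omega> \<bullet> b) 0 \<partial>M)"

definition objective :: "real \<Rightarrow> real^'p \<Rightarrow> real" where
  "objective t b = mean_excess b + (1 - t) * (expectation X \<bullet> b)"

definition score :: "real^'p \<Rightarrow> real^'p" where
  "score b = tail_mean M (\<lambda>\<omega>. Y \<omega> - X \<omega> \<bullet> b) X 0"

definition mean_gap :: "real^'p \<Rightarrow> real^'p \<Rightarrow> real" where
  "mean_gap b c = (\<integral>\<omega>. hinge_gap (Y \<omega>) (X \<omega> \<bullet> b) (X \<omega> \<bullet> c) \<partial>M)"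

lemma is_qr_coef_iff_minimizer: "is_qr_coef M Y X t b \<longleftrightarrow> (\<forall>c. objective t b \<le> objective t c)"
proof -
  have "(\<integral>\<omega>. rho t (Y \<omega> - X \<omega> \<bullet> c) \<partial>M) = objective t c - (1 - t) * expectation Y" for c
    unfolding rho_eq objective_def mean_excess_def
    using integrable_excess integrable_residual integrable_Y integrable_X
    by (simp add: algebra_simps)
  then show ?thesis by (simp add: is_qr_coef_def)
qed

lemma convex_on_mean_excess: "convex_on UNIV mean_excess"
proof (rule convex_onI)
  fix u :: real and b c :: "real^'p"
  assume u: "0 < u" "u < 1"
  have "max (y - x \<bullet> ((1 - u) *\<^sub>R b + u *\<^sub>R c)) 0 \<le>
      (1 - u) * max (y - x \<bullet> b) 0 + u * max (y - x \<bullet> c) 0"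
    for x :: "real^'p" and y
  proof -
    have "(1 - u) * (y - x \<bullet> b) + u * (y - x \<bullet> c) \<le>
        (1 - u) * max (y - x \<bullet> b) 0 + u * max (y - x \<bullet> c) 0"
      using u by (intro add_mono mult_left_mono) auto
    moreover have "0 \<le> (1 - u) * max (y - x \<bullet> b) 0 + u * max (y - x \<bullet> c) 0"
      using u by simp
    moreover have "y - x \<bullet> ((1 - u) *\<^sub>R b + u *\<^sub>R c) = (1 - u) * (y - x \<bullet> b) + u * (y - x \<bullet> c)"
      by (simp add: inner_add_right algebra_simps)
    ultimately show ?thesis by (simp only: max.boundedI)
  qed
  then have "mean_excess ((1 - u) *\<^sub>R b + u *\<^sub>R c) \<le>
      (\<integral>\<omega>. (1 - u) * max (Y \<omega> - X \<omega> \<bullet> b) 0 + u * max (Y \<omega> - X \<omega> \<bullet> c) 0 \<partial>M)"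
    unfolding mean_excess_def using integrable_excess by (intro integral_mono) auto
  then show "mean_excess ((1 - u) *\<^sub>R b + u *\<^sub>R c) \<le> (1 - u) * mean_excess b + u * mean_excess c"
    unfolding mean_excess_def using integrable_excess by simp
qed simp

lemma integrable_hinge_gap: "integrable M (\<lambda>\<omega>. hinge_gap (Y \<omega>) (X \<omega> \<bullet> b) (X \<omega> \<bullet> c))"
proof (rule Bochner_Integration.integrable_bound)
  show "integrable M (\<lambda>\<omega>. X \<omega> \<bullet> c - X \<omega> \<bullet> b)" using integrable_X by simp
qed (use hinge_gap_nonneg hinge_gap_le in auto)

lemma mean_gap_nonneg: "0 \<le> mean_gap b c"
  by (simp add: mean_gap_def hinge_gap_nonneg)

lemma mean_gap_eq_0_iff: "mean_gap b c = 0 \<longleftrightarrow> (AE \<omega> in M. hinge_gap (Y \<omega>) (X \<omega> \<bullet> b) (X \<omega> \<bullet> c) = 0)"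
  unfolding mean_gap_def
  by (intro integral_nonneg_eq_0_iff_AE integrable_hinge_gap) (simp add: hinge_gap_nonneg)

lemma mean_excess_diff: "mean_excess c - mean_excess b = mean_gap b c - score b \<bullet> (c - b)"
proof -
  let ?A = "{\<omega>\<in>space M. 0 < Y \<omega> - X \<omega> \<bullet> b}"
  have "set_integrable M ?A X"
    using integrable_X by (intro integrable_imp_set_integrable) auto
  note inner = set_integrable_linear[OF bounded_linear_inner_left this]
    set_integral_linear[OF bounded_linear_inner_left this]
  have "mean_gap b c = (\<integral>\<omega>. max (Y \<omega> - X \<omega> \<bullet> c) 0 - max (Y \<omega> - X \<omega> \<bullet> b) 0 +
      indicator ?A \<omega> *\<^sub>R (X \<omega> \<bullet> (c - b)) \<partial>M)"
    unfolding mean_gap_def hinge_gap_def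
    by (intro Bochner_Integration.integral_cong) (auto simp: inner_diff_right)
  also have "\<dots> = mean_excess c - mean_excess b + (\<integral>\<omega>\<in>?A. X \<omega> \<bullet> (c - b) \<partial>M)"
    unfolding mean_excess_def set_lebesgue_integral_def
    using inner(1)[unfolded set_integrable_def, of "c - b"] integrable_excess by simp
  also have "(\<integral>\<omega>\<in>?A. X \<omega> \<bullet> (c - b) \<partial>M) = score b \<bullet> (c - b)"
    by (simp only: inner(2) score_def tail_mean_def)
  finally show ?thesis by simp
qed

lemma objective_diff:
  "objective t c - objective t b = mean_gap b c + ((1 - t) *\<^sub>R expectation X - score b) \<bullet> (c - b)"
  using mean_excess_diff[of c b]
  by (simp add: objective_def inner_diff_left inner_diff_right algebra_simps)

lemma is_qr_coefI_score:
  assumes "score b = (1 - t) *\<^sub>R expectation X"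
  shows "is_qr_coef M Y X t b"
  unfolding is_qr_coef_iff_minimizer
proof
  fix c show "objective t b \<le> objective t c"
    using objective_diff[of t c b] mean_gap_nonneg[of b c] by (simp add: assms)
qed

lemma mean_gap_directional_derivative:
  assumes "AE \<omega> in M. Y \<omega> \<noteq> X \<omega> \<bullet> b"
  shows "((\<lambda>r. r * mean_gap b (b + (1 / r) *\<^sub>R h)) \<longlongrightarrow> 0) at_top"
proof -
  let ?g = "\<lambda>r \<omega>. r * hinge_gap (Y \<omega>) (X \<omega> \<bullet> b) (X \<omega> \<bullet> (b + (1 / r) *\<^sub>R h))"
  have "((\<lambda>r. \<integral>\<omega>. ?g r \<omega> \<partial>M) \<longlongrightarrow> (\<integral>\<omega>. 0 \<partial>M)) at_top"
  proof (rule integral_dominated_convergence_at_top)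
    show "integrable M (\<lambda>\<omega>. \<bar>X \<omega> \<bullet> h\<bar>)" using integrable_X by simp
    show "\<forall>\<^sub>F r in at_top. AE \<omega> in M. norm (?g r \<omega>) \<le> \<bar>X \<omega> \<bullet> h\<bar>"
      using eventually_gt_at_top[of 0]
    proof eventually_elim
      case (elim r)
      then have "r * hinge_gap y (x \<bullet> b) (x \<bullet> (b + (1 / r) *\<^sub>R h)) \<le> \<bar>x \<bullet> h\<bar>" for x y
        using hinge_gap_le[of y "x \<bullet> b" "x \<bullet> (b + (1 / r) *\<^sub>R h)"]
        by (simp add: inner_add_right field_simps)
      with elim show ?case by (simp add: abs_mult hinge_gap_nonneg)
    qed
    show "AE \<omega> in M. ((\<lambda>r. ?g r \<omega>) \<longlongrightarrow> 0) at_top"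
      using assms
    proof eventually_elim
      case (elim \<omega>)
      have "((\<lambda>r. \<bar>X \<omega> \<bullet> h\<bar> / r) \<longlongrightarrow> 0) at_top"
        by (intro tendsto_divide_0[OF tendsto_const] filterlim_at_top_imp_at_infinity
            filterlim_ident)
      then have "\<forall>\<^sub>F r in at_top. \<bar>X \<omega> \<bullet> h\<bar> / r < \<bar>Y \<omega> - X \<omega> \<bullet> b\<bar>"
        using elim by (intro order_tendstoD(2)) auto
      then have "\<forall>\<^sub>F r in at_top. ?g r \<omega> = 0"
        using eventually_gt_at_top[of 0]
        by eventually_elim (simp add: hinge_gap_eq_0 inner_add_right)
      then show ?case by (rule tendsto_eventually)
    qed
  qed auto
  then show ?thesis by (simp add: mean_gap_def)
qed

lemma is_qr_coef_iff_score:
  assumes ae: "AE \<omega> in M. Y \<omega> \<noteq> X \<omega> \<bullet> b"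
  shows "is_qr_coef M Y X t b \<longleftrightarrow> score b = (1 - t) *\<^sub>R expectation X"
proof
  assume min: "is_qr_coef M Y X t b"
  define grad where "grad = (1 - t) *\<^sub>R expectation X - score b"
  have "\<forall>\<^sub>F r in at_top. 0 \<le> r * mean_gap b (b + (1 / r) *\<^sub>R - grad) - grad \<bullet> grad"
    using eventually_gt_at_top[of 0]
  proof eventually_elim
    case (elim r)
    have "0 \<le> objective t (b + (1 / r) *\<^sub>R - grad) - objective t b"
      using min by (simp add: is_qr_coef_iff_minimizer)
    also have "\<dots> = mean_gap b (b + (1 / r) *\<^sub>R - grad) - (grad \<bullet> grad) / r"
      using objective_diff[of t "b + (1 / r) *\<^sub>R - grad" b, folded grad_def] by simp
    finally show ?case using elim by (simp add: field_simps)
  qed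
  moreover have "((\<lambda>r. r * mean_gap b (b + (1 / r) *\<^sub>R - grad) - grad \<bullet> grad)
      \<longlongrightarrow> 0 - grad \<bullet> grad) at_top"
    by (intro tendsto_diff tendsto_const mean_gap_directional_derivative ae)
  ultimately have "0 \<le> 0 - grad \<bullet> grad"
    by (intro tendsto_lowerbound[where F=at_top]) auto
  then have "grad = 0" using inner_gt_zero_iff[of grad] by linarith
  then show "score b = (1 - t) *\<^sub>R expectation X" by (simp add: grad_def)
qed (rule is_qr_coefI_score)

end

subsection \<open>Monotone representations and duality\<close>

context linear_regression
begin

definition monotone_representation :: "(real \<Rightarrow> real^'p) \<Rightarrow> ('a \<Rightarrow> real) \<Rightarrow> bool" where
  "monotone_representation \<gamma> V \<longleftrightarrow> unif01 M V \<and> mean_indep M X V \<and>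
     (AE \<omega> in M. Y \<omega> = X \<omega> \<bullet> \<gamma> (V \<omega>)) \<and>
     (AE \<omega> in M. strict_mono_on {0<..<1} (\<lambda>u. X \<omega> \<bullet> \<gamma> u))"

lemma
  assumes "monotone_representation \<gamma> V"
  shows monotone_representation_unif01: "unif01 M V"
    and monotone_representation_mean_indep: "mean_indep M X V"
    and monotone_representation_AE_eq: "AE \<omega> in M. Y \<omega> = X \<omega> \<bullet> \<gamma> (V \<omega>)"
    and monotone_representation_AE_strict_mono: "AE \<omega> in M. strict_mono_on {0<..<1} (\<lambda>u. X \<omega> \<bullet> \<gamma> u)"
  using assms by (simp_all add: monotone_representation_def)

lemma monotone_representation_AE_less_iff:
  assumes rep: "monotone_representation \<gamma> V" and t: "t \<in> {0<..<1}"
  shows "AE \<omega> in M. X \<omega> \<bullet> \<gamma> t < Y \<omega> \<longleftrightarrow> t < V \<omega>"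
  using monotone_representation_AE_eq[OF rep] monotone_representation_AE_strict_mono[OF rep]
    AE_unif01[OF monotone_representation_unif01[OF rep]]
proof eventually_elim
  case (elim \<omega>)
  then show ?case using strict_mono_on_less[OF elim(2) t elim(3)] by simp
qed

lemma set_integral_intercept:
  assumes "\<And>\<omega>. \<omega> \<in> space M \<Longrightarrow> X \<omega> $ i = 1" and A: "A \<in> sets M"
  shows "(\<integral>\<omega>\<in>A. X \<omega> \<partial>M) $ i = prob A"
proof -
  have "(\<integral>\<omega>\<in>A. X \<omega> \<partial>M) $ i = (\<integral>\<omega>\<in>A. X \<omega> $ i \<partial>M)"
    using integrable_imp_set_integrable[OF integrable_X A]
    by (rule set_integral_linear[OF bounded_linear_vec_nth, symmetric])
  also have "\<dots> = (\<integral>\<omega>\<in>A. 1 \<partial>M)"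
    using assms sets.sets_into_space[OF A] by (intro set_lebesgue_integral_cong) auto
  finally show ?thesis using A by (simp add: set_lebesgue_integral_def)
qed

lemma unif01_mean_indepI_tail_mean:
  assumes intercept: "\<And>\<omega>. \<omega> \<in> space M \<Longrightarrow> X \<omega> $ i = 1" and [measurable]: "V \<in> borel_measurable M"
    and tail: "\<And>t. t \<in> {0<..<1} \<Longrightarrow> tail_mean M V X t = (1 - t) *\<^sub>R expectation X"
  shows "unif01 M V" and "mean_indep M X V"
proof -
  have "prob {\<omega>\<in>space M. t < V \<omega>} = 1 - t" if t: "t \<in> {0<..<1}" for t
  proof -
    have "prob {\<omega>\<in>space M. t < V \<omega>} = tail_mean M V X t $ i"
      unfolding tail_mean_def by (subst set_integral_intercept) (simp_all add: intercept)
    also have "\<dots> = (1 - t) * (\<integral>\<omega>\<in>space M. X \<omega> \<partial>M) $ i"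
      unfolding tail[OF t] by (simp add: set_integral_space integrable_X)
    also have "\<dots> = 1 - t"
      by (subst set_integral_intercept) (simp_all add: intercept prob_space)
    finally show ?thesis .
  qed
  then show unif: "unif01 M V" by (simp add: unif01_iff_prob_gt)
  show "mean_indep M X V"
    using tail by (simp add: mean_indep_iff_tail_mean_unif01 integrable_X unif)
qed

lemma monotone_representation_score:
  assumes rep: "monotone_representation \<gamma> V" and t: "t \<in> {0<..<1}"
  shows "score (\<gamma> t) = (1 - t) *\<^sub>R expectation X"
proof -
  note V = monotone_representation_unif01[OF rep] monotone_representation_mean_indep[OF rep]
  note [measurable] = unif01_measurable[OF V(1)]
  have "score (\<gamma> t) = tail_mean M V X t"
    unfolding score_def using monotone_representation_AE_less_iff[OF rep t]
    by (intro tail_mean_cong_AE) auto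
  then show ?thesis using V t by (simp add: mean_indep_iff_tail_mean_unif01 integrable_X)
qed

lemma tail_mean_Y_eq:
  assumes V: "unif01 M V" "mean_indep M X V" and t: "t \<in> {0<..<1}"
  shows "tail_mean M V Y t = tail_mean M V (\<lambda>\<omega>. Y \<omega> - X \<omega> \<bullet> b) t + (1 - t) * (expectation X \<bullet> b)"
proof -
  let ?A = "{\<omega>\<in>space M. t < V \<omega>}"
  note [measurable] = unif01_measurable[OF V(1)]
  have set_int: "set_integrable M ?A Y" "set_integrable M ?A X"
    by (auto intro!: integrable_imp_set_integrable integrable_X integrable_Y)
  note inner = set_integrable_linear[OF bounded_linear_inner_left set_int(2), of b]
    set_integral_linear[OF bounded_linear_inner_left set_int(2), of b]
  have "tail_mean M V (\<lambda>\<omega>. Y \<omega> - X \<omega> \<bullet> b) t = tail_mean M V Y t - tail_mean M V X t \<bullet> b"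
    unfolding tail_mean_def using set_int(1) inner by (simp add: set_integral_diff)
  then show ?thesis using V t by (simp add: mean_indep_iff_tail_mean_unif01 integrable_X)
qed

lemma tail_mean_le_objective:
  assumes V: "unif01 M V" "mean_indep M X V" and t: "t \<in> {0<..<1}"
  shows "tail_mean M V Y t \<le> objective t b"
proof -
  note [measurable] = unif01_measurable[OF V(1)]
  have "tail_mean M V (\<lambda>\<omega>. Y \<omega> - X \<omega> \<bullet> b) t \<le> mean_excess b"
    unfolding tail_mean_def mean_excess_def
    by (intro set_integral_le_integral_pos_part integrable_residual) simp
  then show ?thesis by (simp add: tail_mean_Y_eq[OF V t, of b] objective_def)
qed

lemma monotone_representation_tail_mean:
  assumes rep: "monotone_representation \<gamma> V" and t: "t \<in> {0<..<1}"
  shows "tail_mean M V Y t = objective t (\<gamma> t)"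
proof -
  note V = monotone_representation_unif01[OF rep] monotone_representation_mean_indep[OF rep]
  note [measurable] = unif01_measurable[OF V(1)]
  have "tail_mean M V (\<lambda>\<omega>. Y \<omega> - X \<omega> \<bullet> \<gamma> t) t = mean_excess (\<gamma> t)"
    unfolding tail_mean_def mean_excess_def set_lebesgue_integral_def
  proof (rule integral_cong_AE)
    show "AE \<omega> in M. indicator {\<omega>\<in>space M. t < V \<omega>} \<omega> *\<^sub>R (Y \<omega> - X \<omega> \<bullet> \<gamma> t) =
        max (Y \<omega> - X \<omega> \<bullet> \<gamma> t) 0"
      using monotone_representation_AE_less_iff[OF rep t] AE_space
      by eventually_elim (auto split: split_indicator)
  qed measurable
  then show ?thesis by (simp add: tail_mean_Y_eq[OF V t, of "\<gamma> t"] objective_def)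
qed

lemma monotone_representation_optimal:
  assumes rep: "monotone_representation \<gamma> V" and W: "unif01 M W" "mean_indep M X W"
  shows "(\<integral>\<omega>. W \<omega> * Y \<omega> \<partial>M) \<le> (\<integral>\<omega>. V \<omega> * Y \<omega> \<partial>M)"
proof -
  note V = monotone_representation_unif01[OF rep]
  have layers: "set_integrable lborel {0<..<1} (tail_mean M Z Y)"
      "(\<integral>\<omega>. Z \<omega> * Y \<omega> \<partial>M) = (\<integral>t\<in>{0<..<1}. tail_mean M Z Y t \<partial>lborel)" if Z: "unif01 M Z" for Z
  proof -
    have unit: "AE \<omega> in M. Z \<omega> \<in> {0..1}"
      using AE_unif01[OF Z] by (auto elim: eventually_mono)
    show "set_integrable lborel {0<..<1} (tail_mean M Z Y)"
      by (rule set_integrable_tail_mean[OF unif01_measurable[OF Z] unit integrable_Y])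
    show "(\<integral>\<omega>. Z \<omega> * Y \<omega> \<partial>M) = (\<integral>t\<in>{0<..<1}. tail_mean M Z Y t \<partial>lborel)"
      using integral_scaleR_eq_tail_mean[OF unif01_measurable[OF Z] unit integrable_Y] by simp
  qed
  have "(\<integral>t\<in>{0<..<1}. tail_mean M W Y t \<partial>lborel) \<le> (\<integral>t\<in>{0<..<1}. tail_mean M V Y t \<partial>lborel)"
  proof (rule set_integral_mono[OF layers(1)[OF W(1)] layers(1)[OF V]])
    fix t :: real assume t: "t \<in> {0<..<1}"
    show "tail_mean M W Y t \<le> tail_mean M V Y t"
      unfolding monotone_representation_tail_mean[OF rep t] by (rule tail_mean_le_objective[OF W t])
  qed
  then show ?thesis by (simp add: layers(2)[OF W(1)] layers(2)[OF V])
qed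

end

subsection \<open>Regression with a conditional density\<close>

locale density_regression = linear_regression M Y X
  for M :: "'a measure" and Y and X :: "'a \<Rightarrow> real^'p" +
  fixes f :: "real \<Rightarrow> real^'p \<Rightarrow> real"
  assumes density: "cond_density M Y X f"
    and continuous_density: "\<And>x. continuous_on UNIV (\<lambda>y. f y x)"
    and bounded_density: "\<exists>C. \<forall>y x. \<bar>f y x\<bar> \<le> C"
    and square_integrable_X: "integrable M (\<lambda>\<omega>. (norm (X \<omega>))\<^sup>2)"
begin

lemma density_nonneg: "0 \<le> f y x"
  using density by (simp add: cond_density_def)

lemma borel_measurable_density[measurable]: "(\<lambda>(y, x). f y x) \<in> borel_measurable (borel \<Otimes>\<^sub>M borel)"
  using density by (simp add: cond_density_def borel_prod)

lemma distributed_joint: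
  "distributed M (distr M borel X \<Otimes>\<^sub>M lborel) (\<lambda>\<omega>. (X \<omega>, Y \<omega>)) (\<lambda>(x, y). ennreal (f y x))"
proof (rule distributed_jointI)
  show "sigma_finite_measure (distr M borel X)"
    by (intro prob_space_imp_sigma_finite prob_space_distr) simp
  fix B A assume "B \<in> sets (distr M borel X)" "A \<in> sets (lborel :: real measure)"
  then have [measurable]: "B \<in> sets borel" "A \<in> sets borel" by simp_all
  have "emeasure M {\<omega>\<in>space M. X \<omega> \<in> B \<and> Y \<omega> \<in> A} =
      (\<integral>\<^sup>+\<omega>. indicator B (X \<omega>) * (\<integral>\<^sup>+y. indicator A y * ennreal (f y (X \<omega>)) \<partial>lborel) \<partial>M)"
    using density by (simp add: cond_density_def conj_commute)
  also have "\<dots> = (\<integral>\<^sup>+x. (\<integral>\<^sup>+y. (case (x, y) of (x, y) \<Rightarrow> ennreal (f y x)) * indicator A y \<partial>lborel) *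
      indicator B x \<partial>distr M borel X)"
    by (subst nn_integral_distr) (simp_all add: mult.commute)
  finally show "emeasure M {\<omega>\<in>space M. X \<omega> \<in> B \<and> Y \<omega> \<in> A} = \<dots>" .
qed (simp_all add: sigma_finite_lborel)

lemma AE_conditional_iff:
  assumes [measurable]: "Measurable.pred (borel \<Otimes>\<^sub>M borel) (\<lambda>(x, y). P x y)"
  shows "(AE \<omega> in M. P (X \<omega>) (Y \<omega>)) \<longleftrightarrow> (AE \<omega> in M. AE y in lborel. 0 < f y (X \<omega>) \<longrightarrow> P (X \<omega>) y)"
proof -
  interpret X: prob_space "distr M borel X" by (rule prob_space_distr) simp
  interpret P: pair_sigma_finite "distr M borel X" lborel ..
  note [measurable] = lborel.pred_AE
  have "(AE \<omega> in M. P (X \<omega>) (Y \<omega>)) \<longleftrightarrow>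
      (AE z in distr M (distr M borel X \<Otimes>\<^sub>M lborel) (\<lambda>\<omega>. (X \<omega>, Y \<omega>)). P (fst z) (snd z))"
    by (subst AE_distr_iff; measurable)
  also have "\<dots> \<longleftrightarrow> (AE z in distr M borel X \<Otimes>\<^sub>M lborel. 0 < f (snd z) (fst z) \<longrightarrow> P (fst z) (snd z))"
    unfolding distributed_distr_eq_density[OF distributed_joint]
    by (subst AE_density, measurable) (simp add: split_beta)
  also have "\<dots> \<longleftrightarrow> (AE x in distr M borel X. AE y in lborel. 0 < f y x \<longrightarrow> P x y)"
    by (rule P.AE_pair_iff[symmetric]) measurable
  also have "\<dots> \<longleftrightarrow> (AE \<omega> in M. AE y in lborel. 0 < f y (X \<omega>) \<longrightarrow> P (X \<omega>) y)"
    by (subst AE_distr_iff; measurable)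
  finally show ?thesis .
qed

lemma AE_density_integral_eq_1: "AE \<omega> in M. (\<integral>\<^sup>+y. ennreal (f y (X \<omega>)) \<partial>lborel) = 1"
proof -
  have sigma_finite: "sigma_finite_measure (distr M borel X)"
    by (intro prob_space_imp_sigma_finite prob_space_distr) simp
  have marginal: "distributed M (distr M borel X) X (\<lambda>_. 1)"
    by (auto simp: distributed_def density_1 intro: distr_cong)
  from distributed_marginal_eq_joint1
    [OF sigma_finite_lborel sigma_finite marginal distributed_joint]
  have "AE x in distr M borel X. 1 = (\<integral>\<^sup>+y. ennreal (f y x) \<partial>lborel)" by simp
  then show ?thesis by (subst (asm) AE_distr_iff) (auto elim: eventually_mono)
qed

lemma AE_Y_neq: "AE \<omega> in M. Y \<omega> \<noteq> X \<omega> \<bullet> b"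
proof -
  have "AE y in lborel. 0 < f y (X \<omega>) \<longrightarrow> y \<noteq> X \<omega> \<bullet> b" for \<omega>
    using AE_lborel_singleton[of "X \<omega> \<bullet> b"] by (auto elim: eventually_mono)
  then show ?thesis by (subst AE_conditional_iff) auto
qed

lemma mean_gap_eq_0_imp_density:
  assumes "mean_gap b c = 0"
  shows "AE \<omega> in M. f (X \<omega> \<bullet> b) (X \<omega>) * (X \<omega> \<bullet> (c - b)) = 0"
proof -
  have "AE \<omega> in M. Y \<omega> \<notin> open_segment (X \<omega> \<bullet> b) (X \<omega> \<bullet> c)"
    using assms unfolding mean_gap_eq_0_iff by eventually_elim (rule hinge_gap_eq_0_imp)
  then have "AE \<omega> in M. AE y in lborel. 0 < f y (X \<omega>) \<longrightarrow> y \<notin> open_segment (X \<omega> \<bullet> b) (X \<omega> \<bullet> c)"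
    by (subst (asm) AE_conditional_iff) (simp_all add: mem_open_segment_real)
  then show ?thesis
  proof eventually_elim
    case (elim \<omega>)
    then have "AE y in lborel. y \<in> open_segment (X \<omega> \<bullet> b) (X \<omega> \<bullet> c) \<longrightarrow> f y (X \<omega>) = 0"
      by eventually_elim (use density_nonneg in \<open>auto simp: less_le\<close>)
    then show ?case
      using AE_eq_0_open_segment_imp[OF continuous_density]
      by (cases "X \<omega> \<bullet> b = X \<omega> \<bullet> c") (auto simp: inner_diff_right)
  qed
qed

lemma integrable_jac_mat: "integrable M (\<lambda>\<omega>. f (X \<omega> \<bullet> b) (X \<omega>) * X \<omega> $ i * X \<omega> $ j)"
proof -
  note [measurable] = borel_measurable_nth
  obtain C where C_bound: "\<And>y x. \<bar>f y x\<bar> \<le> C" using bounded_density by auto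
  have bound: "\<bar>f y x * x $ i * x $ j\<bar> \<le> \<bar>C * (norm x)\<^sup>2\<bar>" for y x
  proof -
    have "\<bar>f y x\<bar> * (\<bar>x $ i\<bar> * \<bar>x $ j\<bar>) \<le> C * (norm x * norm x)"
      using C_bound[of y x] by (intro mult_mono component_le_norm_cart) auto
    moreover have "0 \<le> C" using C_bound[of 0 0] by linarith
    ultimately show ?thesis by (simp add: abs_mult power2_eq_square mult.assoc)
  qed
  show ?thesis
  proof (rule Bochner_Integration.integrable_bound)
    show "integrable M (\<lambda>\<omega>. C * (norm (X \<omega>))\<^sup>2)" using square_integrable_X by simp
  qed (simp_all add: bound)
qed

lemma jac_mat_mult_vec_nth:
  "(jac_mat M X f b *v h) $ i = (\<integral>\<omega>. X \<omega> $ i * (f (X \<omega> \<bullet> b) (X \<omega>) * (X \<omega> \<bullet> h)) \<partial>M)"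
proof -
  have "(jac_mat M X f b *v h) $ i =
      (\<Sum>j\<in>UNIV. (\<integral>\<omega>. f (X \<omega> \<bullet> b) (X \<omega>) * X \<omega> $ i * X \<omega> $ j \<partial>M) * h $ j)"
    by (simp add: matrix_vector_mult_def jac_mat_def)
  also have "\<dots> = (\<integral>\<omega>. (\<Sum>j\<in>UNIV. f (X \<omega> \<bullet> b) (X \<omega>) * X \<omega> $ i * X \<omega> $ j * h $ j) \<partial>M)"
    using integrable_jac_mat by simp
  also have "\<dots> = (\<integral>\<omega>. X \<omega> $ i * (f (X \<omega> \<bullet> b) (X \<omega>) * (X \<omega> \<bullet> h)) \<partial>M)"
    by (intro Bochner_Integration.integral_cong)
       (auto simp: inner_vec_def[of _ h] sum_distrib_left ac_simps)
  finally show ?thesis .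
qed

lemma is_qr_coef_unique:
  assumes b: "is_qr_coef M Y X t b" and c: "is_qr_coef M Y X t c"
    and full_rank: "rank (jac_mat M X f b) = CARD('p)"
  shows "c = b"
proof -
  have "objective t c = objective t b"
    using b c by (auto simp: is_qr_coef_iff_minimizer intro: antisym)
  then have "mean_gap b c = 0"
    using objective_diff[of t c b] b by (simp add: is_qr_coef_iff_score[OF AE_Y_neq])
  then have "AE \<omega> in M. f (X \<omega> \<bullet> b) (X \<omega>) * (X \<omega> \<bullet> (c - b)) = 0"
    by (rule mean_gap_eq_0_imp_density)
  then have "(jac_mat M X f b *v (c - b)) $ i = 0" for i
    unfolding jac_mat_mult_vec_nth by (intro integral_eq_zero_AE) (auto elim: eventually_mono)
  then have "jac_mat M X f b *v (c - b) = 0"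
    by (simp add: vec_eq_iff)
  moreover have "inj ((*v) (jac_mat M X f b))"
    using full_rank by (simp add: full_rank_injective)
  ultimately have "c - b = 0"
    by (metis injD matrix_vector_mult_0_right)
  then show ?thesis by simp
qed

lemma continuous_on_qr_coef:
  assumes qr_coef: "\<And>t. t \<in> T \<Longrightarrow> is_qr_coef M Y X t (\<beta> t)"
    and full_rank: "\<And>t. t \<in> T \<Longrightarrow> rank (jac_mat M X f (\<beta> t)) = CARD('p)"
  shows "continuous_on T \<beta>"
proof (rule continuous_on_tilted_minimizer[OF convex_on_mean_excess])
  let ?v = "\<lambda>t. (1 - t) *\<^sub>R expectation X"
  show "continuous_on T ?v" by (intro continuous_intros)
  have objective: "objective t b = mean_excess b + ?v t \<bullet> b" for t b by (simp add: objective_def)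
  show "mean_excess (\<beta> t) + ?v t \<bullet> \<beta> t \<le> mean_excess c + ?v t \<bullet> c" if "t \<in> T" for t c
    using qr_coef[OF that] by (simp add: is_qr_coef_iff_minimizer objective)
  show "b = \<beta> t" if "t \<in> T" "\<And>c. mean_excess b + ?v t \<bullet> b \<le> mean_excess c + ?v t \<bullet> c" for t b
    using that(2)
    by (intro is_qr_coef_unique[OF qr_coef[OF that(1)] _ full_rank[OF that(1)]])
       (simp add: is_qr_coef_iff_minimizer objective)
qed

lemma linear_quantile_monotone_representation:
  assumes quantile: "AE \<omega> in M. \<forall>u\<in>{0<..<1}. cond_quantile f u (X \<omega>) = X \<omega> \<bullet> \<gamma> u"
    and U: "unif01 M U" "indep_rv M U X" and rep: "AE \<omega> in M. Y \<omega> = X \<omega> \<bullet> \<gamma> (U \<omega>)"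
  shows "monotone_representation \<gamma> U"
proof -
  have "AE \<omega> in M. strict_mono_on {0<..<1} (\<lambda>u. X \<omega> \<bullet> \<gamma> u)"
    using quantile AE_density_integral_eq_1
  proof eventually_elim
    case (elim \<omega>)
    have "strict_mono_on {0<..<1} (\<lambda>u. cond_quantile f u (X \<omega>))"
      using elim(2) by (intro cond_quantile_strict_mono density_nonneg) auto
    then show ?case using elim(1) by (simp add: strict_mono_on_def)
  qed
  then show ?thesis
    using U rep by (simp add: monotone_representation_def indep_rv_imp_mean_indep[OF integrable_X])
qed

end

subsection \<open>The quantile regression process\<close>

locale quantile_regression = density_regression M Y X f
  for M :: "'a measure" and Y and X :: "'a \<Rightarrow> real^'p" and f +
  fixes \<beta> :: "real \<Rightarrow> real^'p"
  assumes qr_coef: "t \<in> {0<..<1} \<Longrightarrow> is_qr_coef M Y X t (\<beta> t)"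
    and full_rank: "t \<in> {0<..<1} \<Longrightarrow> rank (jac_mat M X f (\<beta> t)) = CARD('p)"
begin

lemma score_qr_coef: "t \<in> {0<..<1} \<Longrightarrow> score (\<beta> t) = (1 - t) *\<^sub>R expectation X"
  using qr_coef is_qr_coef_iff_score[OF AE_Y_neq] by blast

lemma continuous_on_process: "continuous_on {0<..<1} \<beta>"
  by (rule continuous_on_qr_coef[OF qr_coef full_rank])

end

lemma quantile_regressionI:
  fixes X :: "'a \<Rightarrow> real^'p"
  assumes "prob_space M" and X: "X \<in> borel_measurable M" and "integrable M Y"
    and X2: "integrable M (\<lambda>\<omega>. (norm (X \<omega>))\<^sup>2)" and "cond_density M Y X f"
    and "\<exists>C. \<forall>y x. \<bar>f y x\<bar> \<le> C" and ucont: "uniformly_continuous_on UNIV (\<lambda>(y, x). f y x)"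
    and "\<And>t. t \<in> {0<..<1} \<Longrightarrow> is_qr_coef M Y X t (\<beta> t)"
    and "\<And>t. t \<in> {0<..<1} \<Longrightarrow> rank (jac_mat M X f (\<beta> t)) = CARD('p)"
  shows "quantile_regression M Y X f \<beta>"
proof -
  interpret prob_space M by fact
  have "integrable M X"
    using square_integrable_imp_integrable[of "\<lambda>\<omega>. norm (X \<omega>)"] X X2
    by (simp add: integrable_norm_iff)
  moreover have "continuous_on UNIV (\<lambda>y. f y x)" for x
    using continuous_on_compose2[OF uniformly_continuous_imp_continuous[OF ucont],
        of UNIV "\<lambda>y. (y, x)"]
    by (simp add: continuous_on_Pair)
  ultimately show ?thesis
    using assms by unfold_locales auto
qed

lemma Utilde_eq_lborel_integral:
  "Utilde Y X \<beta> \<omega> = (\<integral>t. indicator {t\<in>{0<..<1}. X \<omega> \<bullet> \<beta> t < Y \<omega>} t \<partial>lborel)"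
proof -
  have "Utilde Y X \<beta> \<omega> = (\<integral>t. indicator {0<..<1} t * (if X \<omega> \<bullet> \<beta> t < Y \<omega> then 1 else 0) \<partial>lborel)"
    by (simp add: Utilde_def interval_lebesgue_integral_def set_lebesgue_integral_def
        zero_ereal_def one_ereal_def)
  also have "\<dots> = (\<integral>t. indicator {t\<in>{0<..<1}. X \<omega> \<bullet> \<beta> t < Y \<omega>} t \<partial>lborel)"
    by (intro Bochner_Integration.integral_cong) (auto split: split_indicator)
  finally show ?thesis .
qed

lemma Utilde_eq_sublevel_length: "Utilde Y X \<beta> \<omega> = sublevel_length (\<lambda>t. X \<omega> \<bullet> \<beta> t) (Y \<omega>)"
  by (simp add: Utilde_eq_lborel_integral sublevel_length_def)

lemma borel_measurable_Utilde:
  assumes [measurable]: "Y \<in> borel_measurable M" "X \<in> borel_measurable M"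
    and cont: "continuous_on {0<..<1} \<beta>"
  shows "Utilde Y X \<beta> \<in> borel_measurable M"
proof -
  \<comment> \<open>Nothing is known about \<open>\<beta>\<close> outside the unit interval, so it is extended by zero.\<close>
  define \<gamma> where "\<gamma> t = indicat_real {0<..<1} t *\<^sub>R \<beta> t" for t
  have [measurable]: "\<gamma> \<in> borel_measurable borel"
    unfolding \<gamma>_def[abs_def] by (rule borel_measurable_continuous_on_indicator[OF _ cont]) simp
  have "Utilde Y X \<beta> \<omega> = (\<integral>t. (if 0 < t \<and> t < 1 \<and> X \<omega> \<bullet> \<gamma> t < Y \<omega> then 1 else 0) \<partial>lborel)" for \<omega>
    unfolding Utilde_eq_lborel_integral
    by (intro Bochner_Integration.integral_cong) (auto simp: \<gamma>_def indicator_def)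
  then have "Utilde Y X \<beta> = (\<lambda>\<omega>. \<integral>t. (if 0 < t \<and> t < 1 \<and> X \<omega> \<bullet> \<gamma> t < Y \<omega> then 1 else 0) \<partial>lborel)"
    by (rule ext)
  also have "\<dots> \<in> borel_measurable M" by measurable
  finally show ?thesis .
qed

context quantile_regression
begin

theorem monotone_representation_unique:
  assumes rep: "monotone_representation \<gamma> V"
  shows "AE \<omega> in M. V \<omega> = Utilde Y X \<beta> \<omega>" and "AE \<omega> in M. \<gamma> (V \<omega>) = \<beta> (V \<omega>)"
proof -
  have coef: "\<gamma> t = \<beta> t" if "t \<in> {0<..<1}" for t
    using that by (intro is_qr_coef_unique[OF qr_coef _ full_rank] is_qr_coefI_score
        monotone_representation_score[OF rep])
  note unit = AE_unif01[OF monotone_representation_unif01[OF rep]]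
  from unit show "AE \<omega> in M. \<gamma> (V \<omega>) = \<beta> (V \<omega>)"
    by eventually_elim (rule coef)
  show "AE \<omega> in M. V \<omega> = Utilde Y X \<beta> \<omega>"
    using monotone_representation_AE_eq[OF rep] monotone_representation_AE_strict_mono[OF rep] unit
  proof eventually_elim
    case (elim \<omega>)
    have "Utilde Y X \<beta> \<omega> = sublevel_length (\<lambda>t. X \<omega> \<bullet> \<gamma> t) (X \<omega> \<bullet> \<gamma> (V \<omega>))"
      using elim(1) coef
      by (auto simp: Utilde_eq_sublevel_length sublevel_length_def
          intro!: arg_cong[where f="measure lborel"])
    also have "\<dots> = V \<omega>" using elim(2,3) by (rule sublevel_length_self)
    finally show ?case ..
  qed
qed

theorem Utilde_monotone_representation:
  assumes intercept: "\<And>\<omega>. \<omega> \<in> space M \<Longrightarrow> X \<omega> $ i = 1"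
    and mono: "\<And>x. x \<in> supp M X \<Longrightarrow> strict_mono_on {0<..<1} (\<lambda>t. x \<bullet> \<beta> t)"
  shows "monotone_representation \<beta> (Utilde Y X \<beta>)"
proof -
  let ?U = "Utilde Y X \<beta>"
  have [measurable]: "?U \<in> borel_measurable M"
    by (rule borel_measurable_Utilde[OF _ _ continuous_on_process]) simp_all
  have AE_mono: "AE \<omega> in M. strict_mono_on {0<..<1} (\<lambda>t. X \<omega> \<bullet> \<beta> t)"
    using AE_in_supp[OF borel_measurable_X] by eventually_elim (rule mono)
  have cont: "continuous_on {0<..<1} (\<lambda>t. X \<omega> \<bullet> \<beta> t)" for \<omega>
    by (intro continuous_intros continuous_on_process)
  have tail: "tail_mean M ?U X t = (1 - t) *\<^sub>R expectation X" if t: "t \<in> {0<..<1}" for t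
  proof -
    have "AE \<omega> in M. t < ?U \<omega> \<longleftrightarrow> 0 < Y \<omega> - X \<omega> \<bullet> \<beta> t"
      using AE_mono unfolding Utilde_eq_sublevel_length
    proof eventually_elim
      case (elim \<omega>)
      show ?case using less_sublevel_length_iff[OF elim cont t] by simp
    qed
    then have "tail_mean M ?U X t = score (\<beta> t)"
      unfolding score_def by (intro tail_mean_cong_AE) auto
    then show ?thesis by (simp add: score_qr_coef[OF t])
  qed
  have unif: "unif01 M ?U" and "mean_indep M X ?U"
    by (rule unif01_mean_indepI_tail_mean[OF intercept _ tail]; simp)+
  moreover have "AE \<omega> in M. Y \<omega> = X \<omega> \<bullet> \<beta> (?U \<omega>)"
    using AE_mono AE_unif01[OF unif] unfolding Utilde_eq_sublevel_length
  proof eventually_elim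
    case (elim \<omega>)
    show ?case using sublevel_length_inverse[OF elim(1) cont elim(2)] by simp
  qed
  ultimately show ?thesis using AE_mono by (simp add: monotone_representation_def)
qed

end

theorem theorem3p3:
  fixes M :: "'a measure" and Y :: "'a \<Rightarrow> real" and X :: "'a \<Rightarrow> real^'p"
    and i1 :: 'p and \<beta> :: "real \<Rightarrow> real^'p" and f :: "real \<Rightarrow> real^'p \<Rightarrow> real"
  assumes P: "prob_space M"
    and Ymeas: "Y \<in> borel_measurable M" and Xmeas: "X \<in> borel_measurable M"
    and intercept: "\<forall>\<omega>\<in>space M. X \<omega> $ i1 = 1"
    and beta: "\<forall>t\<in>{0<..<1}. is_qr_coef M Y X t (\<beta> t)"
    and intY: "integrable M Y"
    and intX2: "integrable M (\<lambda>\<omega>. (norm (X \<omega>))\<^sup>2)"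
    and dens: "cond_density M Y X f"
    and bdd: "\<exists>C. \<forall>y x. \<bar>f y x\<bar> \<le> C"
    and ucont: "uniformly_continuous_on UNIV (\<lambda>(y, x). f y x)"
    and rank: "\<forall>t\<in>{0<..<1}. rank (jac_mat M X f (\<beta> t)) = CARD('p)"
  shows
   "((\<forall>x\<in>supp M X. strict_mono_on {0<..<1} (\<lambda>t. x \<bullet> \<beta> t)) \<longrightarrow>
       ((AE \<omega> in M. Y \<omega> = X \<omega> \<bullet> \<beta> (Utilde Y X \<beta> \<omega>))
        \<and> unif01 M (Utilde Y X \<beta>)
        \<and> mean_indep M X (Utilde Y X \<beta>)
        \<and> (\<forall>V. unif01 M V \<and> mean_indep M X V \<longrightarrow>
               (\<integral>\<omega>. V \<omega> * Y \<omega> \<partial>M) \<le> (\<integral>\<omega>. Utilde Y X \<beta> \<omega> * Y \<omega> \<partial>M)))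
       \<and> (\<forall>\<beta>b Ub. (AE \<omega> in M. Y \<omega> = \<beta>b (Ub \<omega>) \<bullet> X \<omega>) \<and> unif01 M Ub \<and> mean_indep M X Ub
              \<and> (AE \<omega> in M. strict_mono_on {0<..<1} (\<lambda>u. X \<omega> \<bullet> \<beta>b u)) \<longrightarrow>
              (AE \<omega> in M. Utilde Y X \<beta> \<omega> = Ub \<omega>)
              \<and> (AE \<omega> in M. X \<omega> \<bullet> \<beta> (Utilde Y X \<beta> \<omega>) = X \<omega> \<bullet> \<beta>b (Ub \<omega>))))
    \<and> (\<forall>\<beta>0 U. (AE \<omega> in M. \<forall>u\<in>{0<..<1}. cond_quantile f u (X \<omega>) = X \<omega> \<bullet> \<beta>0 u)
              \<and> unif01 M U \<and> indep_rv M U X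
              \<and> (AE \<omega> in M. Y \<omega> = X \<omega> \<bullet> \<beta>0 (U \<omega>)) \<longrightarrow>
              (AE \<omega> in M. U \<omega> = Utilde Y X \<beta> \<omega>) \<and> (AE \<omega> in M. \<beta>0 (U \<omega>) = \<beta> (U \<omega>)))"
proof -
  interpret quantile_regression M Y X f \<beta>
    using assms by (intro quantile_regressionI) auto
  show ?thesis
  proof (intro conjI impI allI; (elim conjE)?)
    assume "\<forall>x\<in>supp M X. strict_mono_on {0<..<1} (\<lambda>t. x \<bullet> \<beta> t)"
    with intercept have rep: "monotone_representation \<beta> (Utilde Y X \<beta>)"
      by (intro Utilde_monotone_representation) auto
    then show "AE \<omega> in M. Y \<omega> = X \<omega> \<bullet> \<beta> (Utilde Y X \<beta> \<omega>)" "unif01 M (Utilde Y X \<beta>)"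
      "mean_indep M X (Utilde Y X \<beta>)"
      by (simp_all add: monotone_representation_def)
    show "(\<integral>\<omega>. V \<omega> * Y \<omega> \<partial>M) \<le> (\<integral>\<omega>. Utilde Y X \<beta> \<omega> * Y \<omega> \<partial>M)"
      if "unif01 M V" "mean_indep M X V" for V
      by (rule monotone_representation_optimal[OF rep that])
  next
    fix \<gamma> V
    assume "AE \<omega> in M. Y \<omega> = \<gamma> (V \<omega>) \<bullet> X \<omega>" "unif01 M V" "mean_indep M X V"
      "AE \<omega> in M. strict_mono_on {0<..<1} (\<lambda>u. X \<omega> \<bullet> \<gamma> u)"
    then have "monotone_representation \<gamma> V" by (simp add: monotone_representation_def inner_commute)
    from monotone_representation_unique[OF this]
    show "AE \<omega> in M. Utilde Y X \<beta> \<omega> = V \<omega>" "AE \<omega> in M. X \<omega> \<bullet> \<beta> (Utilde Y X \<beta> \<omega>) = X \<omega> \<bullet> \<gamma> (V \<omega>)"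
      by (eventually_elim, simp)+
  next
    fix \<gamma> U
    assume "AE \<omega> in M. \<forall>u\<in>{0<..<1}. cond_quantile f u (X \<omega>) = X \<omega> \<bullet> \<gamma> u"
      "unif01 M U" "indep_rv M U X" "AE \<omega> in M. Y \<omega> = X \<omega> \<bullet> \<gamma> (U \<omega>)"
    from monotone_representation_unique[OF linear_quantile_monotone_representation[OF this]]
    show "AE \<omega> in M. U \<omega> = Utilde Y X \<beta> \<omega>" "AE \<omega> in M. \<gamma> (U \<omega>) = \<beta> (U \<omega>)"
      by blast+
  qed
qed

end
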